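(* Let $\tau$ be an arbitrary fixed positive real number. Let $\{u_k\}_{k=1}^N$ and $\{v_k\}_{k=1}^N$ be non-negative numbers such that $$\sum_{k=1}^N(u_k+v_k)=1,\qquad\sum_{k=1}^N v_k>0,$$ and the greatest common divisor of the indices $k$ with $u_k+v_k>0$ equals $1$. Suppose also that there exists either an odd $k\le N$ with $u_k>0$ or an even $k\le N$ with $v_k>0$. Then there exists a function $C$ vanishing at infinity (i.e. $C(t)\to0$ as $t\to+\infty$) such that the following holds. Let $X_1,X_2$ be continuous functions on $\mathbb R$ satisfying, for $j=1,2$, $$|X_j(t)|\le\Pi_je^{-\tau t}\quad\text{for all }t\in\mathbb R^+,\qquad X_j(t)=0\quad\text{for all }t\in\mathbb R^-,$$ where $\Pi_1,\Pi_2$ are positive numbers. Then there exists a unique pair of continuous functions $Z_1,Z_2$ on $\mathbb R$ satisfying, for $j=1,2$, $$Z_j(t)=X_j(t)+\sum_{k=1}^N\bigl(u_kZ_j(t-k)+v_kZ_{3-j}(t-k)\bigr)\quad\text{for all }t\in\mathbb R^+,\qquad Z_j(t)=0\quad\text{for all }t\in\mathbb R^-.$$ Moreover, for $j=1,2$, $$|Z_j(t)-s(t)|\le(\Pi_1+\Pi_2)\cdot C(t)\quad\text{for all }t\in\mathbb R^+,$$ where the continuous $1$-periodic function $s$ is given by $$s(t)=\frac1{2J}\sum_{k=-\infty}^{+\infty}\bigl(X_1(t-k)+X_2(t-k)\bigr),\quad t\in\mathbb R,\qquad J=\sum_{k=1}^N k(u_k+v_k).$$ In particular, $C$ does not depend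 on the choice of $X_1,X_2$.
   Context: $\mathbb R^+$ and $\mathbb R^-$ denote the positive and negative half-lines. *)

theory Defs
  imports "HOL-Analysis.Analysis"
begin

text \<open>The half-lines are open. For continuous functions, which are the only ones considered,
  including the endpoint \<open>0\<close> in either of them gives the same conditions.\<close>

definition admissible_input :: "real \<Rightarrow> real \<Rightarrow> (real \<Rightarrow> real) \<Rightarrow> bool" where
  "admissible_input \<tau> P X \<longleftrightarrow>
     continuous_on UNIV X \<and>
     (\<forall>t>0. \<bar>X t\<bar> \<le> P * exp (- \<tau> * t)) \<and>
     (\<forall>t<0. X t = 0)"

text \<open>The two components are separate functions: \<open>Z\<close> is the component \<open>j\<close> of the equation
  and \<open>W\<close> is the component \<open>3 - j\<close>.\<close>

definition renewal_equation ::
  "nat \<Rightarrow> (nat \<Rightarrow> real) \<Rightarrow> (nat \<Rightarrow> real) \<Rightarrow> (real \<Rightarrow> real) \<Rightarrow> (real \<Rightarrow> real) \<Rightarrow> (real \<Rightarrow> real) \<Rightarrow> bool"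
  where
  "renewal_equation N u v X Z W \<longleftrightarrow>
     (\<forall>t>0. Z t = X t + (\<Sum>k=1..N. u k * Z (t - real k) + v k * W (t - real k)))"

definition renewal_solution ::
  "nat \<Rightarrow> (nat \<Rightarrow> real) \<Rightarrow> (nat \<Rightarrow> real) \<Rightarrow> (real \<Rightarrow> real) \<Rightarrow> (real \<Rightarrow> real) \<Rightarrow>
   (real \<Rightarrow> real) \<Rightarrow> (real \<Rightarrow> real) \<Rightarrow> bool"
  where
  "renewal_solution N u v X1 X2 Z1 Z2 \<longleftrightarrow>
     continuous_on UNIV Z1 \<and> continuous_on UNIV Z2 \<and>
     renewal_equation N u v X1 Z1 Z2 \<and> renewal_equation N u v X2 Z2 Z1 \<and>
     (\<forall>t<0. Z1 t = 0) \<and> (\<forall>t<0. Z2 t = 0)"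

definition mean_step :: "nat \<Rightarrow> (nat \<Rightarrow> real) \<Rightarrow> (nat \<Rightarrow> real) \<Rightarrow> real" where
  "mean_step N u v = (\<Sum>k=1..N. real k * (u k + v k))"

definition periodic_limit ::
  "nat \<Rightarrow> (nat \<Rightarrow> real) \<Rightarrow> (nat \<Rightarrow> real) \<Rightarrow> (real \<Rightarrow> real) \<Rightarrow> (real \<Rightarrow> real) \<Rightarrow> real \<Rightarrow> real" where
  "periodic_limit N u v X1 X2 t =
     1 / (2 * mean_step N u v) *
       (\<Sum>\<^sub>\<infinity>k\<in>(UNIV :: int set). X1 (t - real_of_int k) + X2 (t - real_of_int k))"

end

theory Submission
  imports Defs "HOL-Real_Asymp.Real_Asymp"
begin

text \<open>Read the two components as a renewal process that makes a step of length \<open>k\<close> and keeps its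
  component with weight \<open>u k\<close>, or switches it with weight \<open>v k\<close>. Since inputs vanish on the
  non-positive half-line, the solution is
  \<open>Z\<^sub>1 t = (\<Sum>m. a m * X\<^sub>1 (t - m) + b m * X\<^sub>2 (t - m))\<close>, where \<open>a m\<close> and \<open>b m\<close> are the expected
  numbers of visits at time \<open>m\<close> in the initial component and in the other one; \<open>Z\<^sub>2\<close> is obtained
  by exchanging \<open>a\<close> and \<open>b\<close> (\<open>renewal_solution_convolve\<close>). Uniqueness follows by induction on
  \<open>\<lceil>t\<rceil>\<close>.

  The core is that \<open>a\<close> and \<open>b\<close> both converge to \<open>1 / (2 * J)\<close> (\<open>fundamental_tendsto\<close>). Let \<open>\<eta>\<close>
  be the larger of the two upper limits, attained along a subsequence of times. Each value is a
  weighted mean of earlier values, so all values that are earlier by one step of positive weight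
  also tend to \<open>\<eta>\<close> along that subsequence, hence so do all values earlier by any sum of steps.
  The condition on the greatest common divisor and the parity condition make every sufficiently
  long displacement, with either effect on the component, a sum of steps
  (\<open>reach_cofinite_if_aperiodic\<close>). Thus a whole window of length \<open>N\<close>, in both components, tends
  to \<open>\<eta>\<close>, and the conserved quantity \<open>F_conserved\<close> forces \<open>2 * J * \<eta> = 1\<close>. The same argument
  applied to \<open>- a\<close> and \<open>- b\<close> identifies the lower limits.

  Finally \<open>Z\<^sub>j - s\<close> is the convolution of the null sequences \<open>a - 1 / (2 * J)\<close> and
  \<open>b - 1 / (2 * J)\<close> with exponentially decaying inputs, up to the exponentially small part of the
  series for \<open>s\<close> that involves times beyond \<open>t\<close> (\<open>convolve_near_periodization\<close>).\<close>

section \<open>Numerical semigroups\<close>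

lemma numerical_semigroup_cofinite:
  fixes A :: "nat set"
  assumes zero: "0 \<in> A"
    and add: "\<And>a b. a \<in> A \<Longrightarrow> b \<in> A \<Longrightarrow> a + b \<in> A"
    and gcd: "\<And>d. (\<And>a. a \<in> A \<Longrightarrow> d dvd a) \<Longrightarrow> d = 1"
  shows "\<exists>L. \<forall>n\<ge>L. n \<in> A"
proof -
  have mult: "q * a \<in> A" if "a \<in> A" for q a
    by (induction q) (use zero add that in auto)
  define D where "D = {d. d > 0 \<and> (\<exists>x\<in>A. x + d \<in> A)}"
  have "\<exists>a\<in>A. a \<noteq> 0"
  proof (rule ccontr)
    assume "\<not> ?thesis"
    then show False using gcd[of 0] by simp
  qed
  then have "\<exists>d. d \<in> D"
    unfolding D_def using zero by force
  \<comment> \<open>The least positive difference divides every element, hence is 1; so some \<open>x\<close> and \<open>x + 1\<close> both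
    belong to the semigroup, and every \<open>n \<ge> x\<^sup>2\<close> is a sum of copies of them.\<close>
  define d where "d = (LEAST d. d \<in> D)"
  have d: "d \<in> D" using \<open>\<exists>d. d \<in> D\<close> unfolding d_def by (rule LeastI_ex)
  have least: "d \<le> d'" if "d' \<in> D" for d'
    using that unfolding d_def by (rule Least_le)
  from d obtain x where x: "x \<in> A" "x + d \<in> A" and "d > 0"
    unfolding D_def by auto
  have "d dvd a" if a: "a \<in> A" for a
  proof (rule ccontr)
    assume nd: "\<not> d dvd a"
    define q where "q = a div d"
    \<comment> \<open>The remainder is itself a difference of two elements of \<open>A\<close>.\<close>
    have "q * (x + d) + a mod d = a + q * x"
      unfolding q_def by (simp add: algebra_simps)
    moreover have "q * (x + d) \<in> A" "a + q * x \<in> A"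
      using mult add x a by auto
    moreover have "a mod d > 0" using nd by (auto simp: dvd_eq_mod_eq_0)
    ultimately have "a mod d \<in> D"
      unfolding D_def by (intro CollectI conjI bexI[of _ "q * (x + d)"]) simp_all
    then show False
      using least[of "a mod d"] mod_less_divisor[OF \<open>d > 0\<close>, of a] by linarith
  qed
  then have "d = 1" by (rule gcd)
  with x have x1: "x + 1 \<in> A" by simp
  have "n \<in> A" if n: "n \<ge> x * x" for n
  proof (cases "x = 0")
    case True
    then show ?thesis using mult[OF x1, of n] by simp
  next
    case False
    define q r where "q = n div x" and "r = n mod x"
    have "r < x" using False by (simp add: r_def)
    moreover have "x \<le> q"
      using n False by (simp add: q_def less_eq_div_iff_mult_less_eq)
    ultimately have "r \<le> q" by simp
    have "n = q * x + r" by (simp add: q_def r_def)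
    also have "\<dots> = (q - r) * x + r * (x + 1)"
      using \<open>r \<le> q\<close> by (simp add: algebra_simps diff_mult_distrib)
    also have "\<dots> \<in> A" using mult add x(1) x1 by blast
    finally show ?thesis .
  qed
  then show ?thesis by blast
qed

section \<open>Limits of weighted means\<close>

text \<open>If a mean attains in the limit the asymptotic upper bound of its terms, then so does every
  term of positive weight.\<close>

lemma weighted_mean_extremal_limit:
  fixes w :: "'i \<Rightarrow> real" and x :: "'i \<Rightarrow> 'n \<Rightarrow> real"
  assumes fin: "finite I"
    and w: "\<And>i. i \<in> I \<Longrightarrow> w i \<ge> 0" "sum w I = 1"
    and bound: "\<And>i e. i \<in> I \<Longrightarrow> e > 0 \<Longrightarrow> \<forall>\<^sub>F n in G. x i n < \<eta> + e"
    and mean: "((\<lambda>n. \<Sum>i\<in>I. w i * x i n) \<longlongrightarrow> \<eta>) G"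
    and j: "j \<in> I" "w j > 0"
  shows "(x j \<longlongrightarrow> \<eta>) G"
proof (rule tendstoI)
  fix e :: real assume "e > 0"
  define d where "d = e * w j / 2"
  have wj: "w j \<le> 1"
    using member_le_sum[OF j(1) _ fin, of w] w by auto
  have "d > 0" using \<open>e > 0\<close> j by (simp add: d_def)
  have "d < e" using \<open>e > 0\<close> wj j unfolding d_def
    by (smt (verit) mult_less_cancel_left_pos mult_cancel_left2 field_sum_of_halves zero_less_mult_iff)
  have "\<forall>\<^sub>F n in G. \<forall>i\<in>I. x i n < \<eta> + d"
    using bound \<open>d > 0\<close> fin by (simp add: eventually_ball_finite)
  moreover have "\<forall>\<^sub>F n in G. (\<Sum>i\<in>I. w i * x i n) > \<eta> - d"
    using mean \<open>d > 0\<close> by (simp add: order_tendsto_iff)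
  ultimately show "\<forall>\<^sub>F n in G. dist (x j n) \<eta> < e"
  proof eventually_elim
    case (elim n)
    have "(\<Sum>i\<in>I. w i * x i n) = w j * x j n + (\<Sum>i\<in>I-{j}. w i * x i n)"
      using fin j by (simp add: sum.remove)
    also have "\<dots> \<le> w j * x j n + (\<Sum>i\<in>I-{j}. w i * (\<eta> + d))"
      using elim w by (intro add_left_mono sum_mono mult_left_mono) (auto intro: less_imp_le)
    also have "(\<Sum>i\<in>I-{j}. w i * (\<eta> + d)) = (1 - w j) * (\<eta> + d)"
      using w fin j by (simp add: sum_distrib_right[symmetric] sum_diff1)
    finally have "\<eta> - d < w j * x j n + (1 - w j) * (\<eta> + d)"
      using elim by simp
    then have "w j * (\<eta> - x j n) < 2 * d - w j * d"
      by (simp add: algebra_simps)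
    also have "\<dots> \<le> w j * e" using \<open>d > 0\<close> j by (simp add: d_def)
    finally have "\<eta> - x j n < e" using j by simp
    moreover have "x j n < \<eta> + e" using elim j \<open>d < e\<close> by fastforce
    ultimately show ?case by (simp add: dist_real_def abs_less_iff)
  qed
qed

lemma bounded_limsup_subseq:
  fixes x :: "nat \<Rightarrow> real"
  assumes "\<And>n. \<bar>x n\<bar> \<le> B"
  obtains \<eta> r where "strict_mono (r :: nat \<Rightarrow> nat)" "(\<lambda>n. x (r n)) \<longlonglongrightarrow> \<eta>"
    "\<And>e. e > 0 \<Longrightarrow> \<forall>\<^sub>F n in sequentially. x n < \<eta> + e"
proof -
  define y where "y = (\<lambda>n. ereal (x n))"
  obtain r :: "nat \<Rightarrow> nat" where r: "strict_mono r" "(y \<circ> r) \<longlonglongrightarrow> limsup y"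
    using limsup_subseq_lim by blast
  have "limsup y \<le> ereal B"
    by (rule Limsup_bounded) (use assms in \<open>auto simp: y_def abs_le_iff intro!: always_eventually\<close>)
  moreover have "ereal (- B) \<le> limsup y"
  proof (rule LIMSEQ_le_const[OF r(2)])
    show "\<exists>N. \<forall>n\<ge>N. ereal (- B) \<le> (y \<circ> r) n"
      using assms by (auto simp: y_def abs_le_iff intro: minus_le_iff[THEN iffD1])
  qed
  ultimately obtain \<eta> where \<eta>: "limsup y = ereal \<eta>"
    by (cases "limsup y") auto
  show ?thesis
  proof
    show "strict_mono r" by fact
    show "(\<lambda>n. x (r n)) \<longlonglongrightarrow> \<eta>"
      using r(2) unfolding \<eta> by (simp add: y_def o_def)
    show "\<forall>\<^sub>F n in sequentially. x n < \<eta> + e" if "e > 0" for e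
    proof -
      have "limsup y < ereal (\<eta> + e)" using that by (simp add: \<eta>)
      then have "\<forall>\<^sub>F n in sequentially. y n < ereal (\<eta> + e)" by (rule Limsup_lessD)
      then show ?thesis by (simp add: y_def)
    qed
  qed
qed

lemma geometric_convolution_tendsto_zero:
  fixes \<delta> :: "nat \<Rightarrow> real"
  assumes \<delta>: "\<delta> \<longlonglongrightarrow> 0" "\<And>n. \<delta> n \<ge> 0" and q: "0 < q" "q < 1"
  shows "(\<lambda>n. \<Sum>m\<le>n. \<delta> m * q ^ (n - m)) \<longlonglongrightarrow> 0"
proof (rule tendstoI)
  fix e :: real assume "e > 0"
  define c where "c n = (\<Sum>m\<le>n. \<delta> m * q ^ (n - m))" for n
  have c_Suc: "c (Suc n) = \<delta> (Suc n) + q * c n" for n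
    unfolding c_def by (simp add: sum_distrib_left Suc_diff_le mult.left_commute)
  have c_nonneg: "c n \<ge> 0" for n
    unfolding c_def using \<delta> q by (intro sum_nonneg) auto
  define d where "d = e / 2"
  have "d > 0" using \<open>e > 0\<close> by (simp add: d_def)
  then have "d * (1 - q) > 0" using q by simp
  then have "\<forall>\<^sub>F n in sequentially. \<delta> n < d * (1 - q)"
    using \<delta>(1) by (simp add: order_tendsto_iff)
  then obtain n0 where n0: "\<And>n. n \<ge> n0 \<Longrightarrow> \<delta> n < d * (1 - q)"
    by (auto simp: eventually_sequentially)
  have decay: "c (n0 + k) - d \<le> q ^ k * \<bar>c n0 - d\<bar>" for k
  proof (induction k)
    case (Suc k)
    have "c (n0 + Suc k) - d \<le> d * (1 - q) + q * c (n0 + k) - d"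
      using n0[of "n0 + Suc k"] by (simp add: c_Suc)
    also have "\<dots> = q * (c (n0 + k) - d)" by (simp add: algebra_simps)
    also have "\<dots> \<le> q * (q ^ k * \<bar>c n0 - d\<bar>)"
      using Suc q by (intro mult_left_mono) auto
    finally show ?case by (simp add: mult.assoc)
  qed simp
  have "(\<lambda>k. q ^ k * \<bar>c n0 - d\<bar>) \<longlonglongrightarrow> 0"
    using q by (intro tendsto_mult_left_zero LIMSEQ_power_zero) auto
  then have "\<forall>\<^sub>F k in sequentially. q ^ k * \<bar>c n0 - d\<bar> < d"
    using \<open>d > 0\<close> by (simp add: order_tendsto_iff)
  then have "\<forall>\<^sub>F k in sequentially. c (k + n0) < e"
  proof eventually_elim
    case (elim k)
    then show ?case using decay[of k] by (simp add: d_def add.commute)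
  qed
  then have "\<forall>\<^sub>F k in sequentially. c k < e"
    by (rule eventually_sequentially_seg[THEN iffD1])
  then show "\<forall>\<^sub>F n in sequentially. dist (\<Sum>m\<le>n. \<delta> m * q ^ (n - m)) 0 < e"
    using c_nonneg by (simp add: c_def dist_real_def)
qed

section \<open>Reachable displacements and the fundamental solution\<close>

text \<open>The weight \<open>w k d\<close> belongs to the step of length \<open>k\<close> that keeps the component if \<open>d\<close> is
  \<open>False\<close> and switches it if \<open>d\<close> is \<open>True\<close>. Components are Booleans as well, so that a step with
  effect \<open>d\<close> moves from component \<open>s\<close> to component \<open>s \<noteq> d\<close> (exclusive or). The predicate
  \<open>reach w n d\<close> says that some sequence of steps of positive weight has total length \<open>n\<close> and total
  effect \<open>d\<close>.\<close>

inductive reach :: "(nat \<Rightarrow> bool \<Rightarrow> real) \<Rightarrow> nat \<Rightarrow> bool \<Rightarrow> bool" for w where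
  reach_zero: "reach w 0 False"
| reach_step: "reach w n e \<Longrightarrow> w k d > 0 \<Longrightarrow> reach w (n + k) (e \<noteq> d)"

lemma reach_add:
  assumes "reach w m d" "reach w n e"
  shows "reach w (n + m) (e \<noteq> d)"
  using assms
proof (induction rule: reach.induct)
  case (reach_step m d k d')
  then have "reach w ((n + m) + k) ((e \<noteq> d) \<noteq> d')"
    by (intro reach.reach_step[of w "n + m" "e \<noteq> d" k d'] reach_step)
  moreover have "((e \<noteq> d) \<noteq> d') = (e \<noteq> (d \<noteq> d'))" by auto
  ultimately show ?case by (simp add: add.assoc)
qed simp

lemma reach_single:
  assumes "w k d > 0" shows "reach w k d"
  using reach_step[of w 0 False k d] reach_zero assms by simp

text \<open>The displacements that keep the component form a numerical semigroup. If an even \<open>g\<close> divided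
  all of them, then component-keeping steps would be even and component-switching steps would all
  have the same parity: excluded by \<open>gcd\<close> if that parity is even, and by \<open>k1\<close> if it is odd.
  An odd \<open>g\<close> divides every step length \<open>k\<close>, since it divides \<open>2 * k\<close>, so it is \<open>1\<close> by \<open>gcd\<close>.\<close>

lemma reach_cofinite_if_aperiodic:
  fixes w :: "nat \<Rightarrow> bool \<Rightarrow> real"
  assumes gcd: "Gcd {k. \<exists>d. w k d > 0} = 1"
    and k0: "w k0 True > 0"
    and k1: "odd k1 \<and> w k1 False > 0 \<or> even k1 \<and> w k1 True > 0"
  shows "\<exists>L. \<forall>n\<ge>L. \<forall>d. reach w n d"
proof -
  have gcd_1: "g = 1" if "\<And>k d. w k d > 0 \<Longrightarrow> g dvd k" for g
  proof -
    have "g dvd Gcd {k. \<exists>d. w k d > 0}" using that by (intro Gcd_greatest) auto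
    then show ?thesis by (simp add: gcd)
  qed
  have "\<exists>L. \<forall>n\<ge>L. n \<in> {n. reach w n False}"
  proof (rule numerical_semigroup_cofinite)
    show "0 \<in> {n. reach w n False}" by (simp add: reach_zero)
    show "a + b \<in> {n. reach w n False}"
      if "a \<in> {n. reach w n False}" "b \<in> {n. reach w n False}" for a b
      using reach_add[of w b False a False] that by simp
    fix g assume "\<And>a. a \<in> {n. reach w n False} \<Longrightarrow> g dvd a"
    then have g: "g dvd n" if "reach w n False" for n using that by simp
    have g_False: "g dvd k" if "w k False > 0" for k
      using g reach_single that by blast
    have g_True: "g dvd k + l" if "w k True > 0" "w l True > 0" for k l
      using g reach_add[OF reach_single[of w l True] reach_single[of w k True]] that by simp
    show "g = 1"
    proof (cases "even g")
      case True
      have e_False: "even k" if "w k False > 0" for k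
        using g_False[OF that] True by (rule dvd_trans[rotated])
      have e_True: "even (k + l)" if "w k True > 0" "w l True > 0" for k l
        using g_True[OF that] True by (rule dvd_trans[rotated])
      have "even k" if "w k d > 0" for k d
      proof (cases d)
        case True
        then show ?thesis using that k1 e_False[of k1] e_True[of k k1] by auto
      qed (use that e_False in auto)
      then have "(2::nat) = 1" by (rule gcd_1)
      then show ?thesis by simp
    next
      case False
      have "g dvd k" if "w k d > 0" for k d
      proof (cases d)
        case True
        then have "g dvd 2 * k" using g_True[of k k] that by (simp add: mult_2)
        moreover have "coprime g 2" using False by simp
        ultimately show ?thesis by (simp add: coprime_dvd_mult_right_iff)
      qed (use that g_False in auto)
      then show ?thesis by (rule gcd_1)
    qed
  qed
  then obtain L where L: "\<And>n. n \<ge> L \<Longrightarrow> reach w n False" by auto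
  have "reach w n d" if "n \<ge> L + k0" for n d
  proof (cases d)
    case True
    have "reach w ((n - k0) + k0) (False \<noteq> True)"
      using L[of "n - k0"] that k0 by (intro reach_step) auto
    then show ?thesis using True that by simp
  qed (use L that in auto)
  then show ?thesis by blast
qed

text \<open>The solution of the discrete recursion with unit input at time \<open>0\<close> in component \<open>False\<close>: the
  expected number of visits of the renewal process to component \<open>s\<close> at time \<open>n\<close>. Values at negative
  times are understood to be zero, which here means that the sum starts at \<open>m = 0\<close>.\<close>

fun fundamental :: "(nat \<Rightarrow> bool \<Rightarrow> real) \<Rightarrow> nat \<Rightarrow> bool \<Rightarrow> real" where
  "fundamental w 0 s = (if s then 0 else 1)"
| "fundamental w (Suc n) s =
     (\<Sum>m\<le>n. w (Suc n - m) False * fundamental w m s + w (Suc n - m) True * fundamental w m (\<not> s))"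

section \<open>The discrete renewal theorem\<close>

text \<open>Step weights of total mass one supported on lengths from \<open>1\<close> to \<open>N\<close>, for which every
  sufficiently long displacement is reachable with either effect on the component.\<close>

locale renewal_walk =
  fixes N :: nat and w :: "nat \<Rightarrow> bool \<Rightarrow> real"
  assumes w_nonneg: "w k d \<ge> 0"
    and w_support: "k \<notin> {1..N} \<Longrightarrow> w k d = 0"
    and w_total: "(\<Sum>k=1..N. w k False + w k True) = 1"
    and reach_cofinite: "\<exists>L. \<forall>n\<ge>L. \<forall>d. reach w n d"
begin

abbreviation F where "F \<equiv> fundamental w"

text \<open>The mean step length.\<close>

definition J :: real where "J = (\<Sum>k=1..N. real k * (w k False + w k True))"

text \<open>The probability that a step is longer than \<open>k\<close>.\<close>

definition tail :: "nat \<Rightarrow> real" where "tail k = (\<Sum>j=Suc k..N. w j False + w j True)"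

lemma tail_0: "tail 0 = 1"
  using w_total by (simp add: tail_def)

lemma tail_eq_0: "k \<ge> N \<Longrightarrow> tail k = 0"
  by (simp add: tail_def)

lemma tail_Suc: "w (Suc k) False + w (Suc k) True + tail (Suc k) = tail k"
proof (cases "Suc k \<le> N")
  case True
  then show ?thesis
    unfolding tail_def by (simp add: sum.atLeast_Suc_atMost[of "Suc k"])
next
  case False
  then show ?thesis by (simp add: tail_def w_support)
qed

lemma sum_tail: "(\<Sum>k<N. tail k) = J"
proof -
  have "(\<Sum>k<N. tail k) = (\<Sum>k<N. \<Sum>j\<in>{1..N}. if k < j then w j False + w j True else 0)"
    unfolding tail_def
    by (intro sum.cong refl sum.mono_neutral_cong_left) auto
  also have "\<dots> = (\<Sum>j\<in>{1..N}. \<Sum>k<N. if k < j then w j False + w j True else 0)"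
    by (rule sum.swap)
  also have "\<dots> = (\<Sum>j\<in>{1..N}. \<Sum>k<j. w j False + w j True)"
    by (intro sum.cong refl sum.mono_neutral_cong_right) auto
  finally show ?thesis by (simp add: J_def)
qed

lemma J_ge_1: "J \<ge> 1"
proof -
  have "(\<Sum>k=1..N. 1 * (w k False + w k True)) \<le> J"
    unfolding J_def by (intro sum_mono mult_right_mono) (auto simp: w_nonneg)
  then show ?thesis using w_total by simp
qed

lemma F_rec:
  assumes "n \<ge> 1"
  shows "F n s = (\<Sum>k=1..n. w k False * F (n - k) s + w k True * F (n - k) (\<not> s))"
proof -
  obtain n' where n': "n = Suc n'" using assms by (cases n) auto
  show ?thesis
    unfolding n' fundamental.simps
    by (rule sum.reindex_bij_witness[of _ "\<lambda>k. Suc n' - k" "\<lambda>m. Suc n' - m"]) auto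
qed

lemma F_rec_window:
  assumes "n \<ge> N"
  shows "F n s = (\<Sum>(k,d)\<in>{1..N} \<times> UNIV. w k d * F (n - k) (s \<noteq> d))"
proof -
  have "N \<ge> 1" using w_total by (cases N) auto
  have "F n s = (\<Sum>k=1..N. w k False * F (n - k) s + w k True * F (n - k) (\<not> s))"
    using assms \<open>N \<ge> 1\<close> w_support
    by (subst F_rec) (auto intro!: sum.mono_neutral_right)
  also have "\<dots> = (\<Sum>k=1..N. \<Sum>d\<in>UNIV. w k d * F (n - k) (s \<noteq> d))"
    by (simp add: UNIV_bool add.commute)
  finally show ?thesis by (simp add: sum.cartesian_product)
qed

lemma F_bounds: "0 \<le> F n s \<and> F n s \<le> 1"
proof (induction n arbitrary: s rule: less_induct)
  case (less n)
  show ?case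
  proof (cases "n = 0")
    case False
    have "0 \<le> F n s"
      using less w_nonneg False by (subst F_rec) (auto intro!: sum_nonneg add_nonneg_nonneg mult_nonneg_nonneg)
    have "F n s \<le> (\<Sum>k=1..n. w k False * 1 + w k True * 1)"
      using less w_nonneg False
      by (subst F_rec) (auto intro!: sum_mono add_mono mult_left_le)
    also have "\<dots> = (\<Sum>k\<in>{1..n} \<inter> {1..N}. w k False + w k True)"
      using w_support by (intro sum.mono_neutral_cong_right) auto
    also have "\<dots> \<le> (\<Sum>k=1..N. w k False + w k True)"
      using w_nonneg by (intro sum_mono2) (auto intro: add_nonneg_nonneg)
    finally show ?thesis using w_total \<open>0 \<le> F n s\<close> by simp
  qed auto
qed

text \<open>The process started at time \<open>0\<close> makes exactly one step that begins at some time \<open>m \<le> n\<close> and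
  ends after \<open>n\<close>; the summands are the probabilities of the possible values of \<open>m\<close>.\<close>

lemma F_conserved: "(\<Sum>m\<le>n. (F m False + F m True) * tail (n - m)) = 1"
proof (induction n)
  case (Suc n)
  have "F (Suc n) False + F (Suc n) True
      = (\<Sum>m\<le>n. (F m False + F m True) * (w (Suc n - m) False + w (Suc n - m) True))"
    by (simp add: sum.distrib[symmetric] algebra_simps)
  also have "\<dots> = (\<Sum>m\<le>n. (F m False + F m True) * (w (Suc (n - m)) False + w (Suc (n - m)) True))"
    by (simp add: Suc_diff_le)
  finally have "(\<Sum>m\<le>Suc n. (F m False + F m True) * tail (Suc n - m))
     = (\<Sum>m\<le>n. (F m False + F m True) *
          (w (Suc (n - m)) False + w (Suc (n - m)) True + tail (Suc (n - m))))"
    by (simp add: tail_0 sum.distrib distrib_left Suc_diff_le)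
  then show ?case using Suc by (simp add: tail_Suc)
qed (simp add: tail_0)

lemma F_conserved_window:
  assumes "n \<ge> N"
  shows "(\<Sum>k<N. tail k * (F (n - k) False + F (n - k) True)) = 1"
proof -
  have "(\<Sum>k<N. tail k * (F (n - k) False + F (n - k) True))
      = (\<Sum>k\<le>n. tail k * (F (n - k) False + F (n - k) True))"
    using assms by (intro sum.mono_neutral_left) (auto simp: tail_eq_0)
  also have "\<dots> = (\<Sum>m\<le>n. (F m False + F m True) * tail (n - m))"
    by (rule sum.reindex_bij_witness[of _ "\<lambda>k. n - k" "\<lambda>m. n - m"]) auto
  finally show ?thesis by (simp add: F_conserved)
qed

text \<open>This is stated for an arbitrary bounded solution of the recursion, so that it applies to the
  fundamental solution and to its negative.\<close>

lemma limsup_bound: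
  fixes G :: "nat \<Rightarrow> bool \<Rightarrow> real"
  assumes bounded: "\<And>n s. \<bar>G n s\<bar> \<le> B"
    and rec: "\<And>n s. n \<ge> N \<Longrightarrow> G n s = (\<Sum>(k,d)\<in>{1..N} \<times> UNIV. w k d * G (n - k) (s \<noteq> d))"
    and conserved: "\<And>n. n \<ge> N \<Longrightarrow> (\<Sum>k<N. tail k * (G (n - k) False + G (n - k) True)) = K"
    and "e > 0"
  shows "\<forall>\<^sub>F n in sequentially. G n s < K / (2 * J) + e"
proof -
  have "\<exists>\<eta> r. strict_mono (r :: nat \<Rightarrow> nat) \<and> (\<lambda>n. G (r n) s) \<longlonglongrightarrow> \<eta> \<and>
        (\<forall>e>0. \<forall>\<^sub>F n in sequentially. G n s < \<eta> + e)" for s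
    using bounded_limsup_subseq[of "\<lambda>n. G n s" B] bounded by metis
  then obtain \<eta>' r' where r': "\<And>s. strict_mono (r' s :: nat \<Rightarrow> nat)"
      "\<And>s. (\<lambda>n. G (r' s n) s) \<longlonglongrightarrow> \<eta>' s"
      "\<And>s e. e > 0 \<Longrightarrow> \<forall>\<^sub>F n in sequentially. G n s < \<eta>' s + e"
    by metis
  obtain s0 where s0: "\<And>s. \<eta>' s \<le> \<eta>' s0"
  proof (cases "\<eta>' False \<le> \<eta>' True")
    case True
    show ?thesis by (rule that[of True]) (metis True order_refl)
  next
    case False
    show ?thesis by (rule that[of False]) (metis False linear order_refl)
  qed
  define \<eta> r where "\<eta> = \<eta>' s0" and "r = r' s0"
  have upper: "\<forall>\<^sub>F n in sequentially. G n s < \<eta> + e" if "e > 0" for s e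
    using r'(3)[OF that, of s] by eventually_elim (use s0[of s] in \<open>simp add: \<eta>_def\<close>)
  have lim: "filterlim (\<lambda>i. r i - n) at_top sequentially" for n
    unfolding r_def
    using filterlim_compose[OF filterlim_minus_const_nat_at_top filterlim_subseq[OF r'(1)]] .
  \<comment> \<open>The extremal value propagates from times \<open>r i\<close> backwards along all reachable displacements.\<close>
  have spread: "(\<lambda>i. G (r i - n) (s0 \<noteq> d)) \<longlonglongrightarrow> \<eta>" if "reach w n d" for n d
    using that
  proof (induction rule: reach.induct)
    case reach_zero
    show ?case using r'(2)[of s0] by (simp add: \<eta>_def r_def)
  next
    case (reach_step n d k d')
    define x where "x = (\<lambda>(k, d'') i. G (r i - (n + k)) ((s0 \<noteq> d) \<noteq> d''))"
    have "(x (k, d') \<longlongrightarrow> \<eta>) sequentially"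
    proof (rule weighted_mean_extremal_limit)
      show "finite ({1..N} \<times> (UNIV :: bool set))" by simp
      show "case_prod w i \<ge> 0" for i by (auto simp: w_nonneg split: prod.split)
      show "sum (case_prod w) ({1..N} \<times> UNIV) = 1"
        using w_total by (simp add: sum.cartesian_product[symmetric] UNIV_bool add.commute)
      show "\<forall>\<^sub>F i in sequentially. x j i < \<eta> + e" if "e > 0" for j e
        using eventually_compose_filterlim[OF upper[OF that] lim]
        by (auto simp: x_def split: prod.split)
      show "(k, d') \<in> {1..N} \<times> UNIV"
        using reach_step(2) w_support[of k d'] by fastforce
      show "case_prod w (k, d') > 0" using reach_step by simp
      have "\<forall>\<^sub>F i in sequentially. G (r i - n) (s0 \<noteq> d)
          = (\<Sum>j\<in>{1..N} \<times> UNIV. case_prod w j * x j i)"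
        using eventually_compose_filterlim[OF eventually_ge_at_top[of N] lim[of n]]
        by eventually_elim (subst rec, auto simp: x_def case_prod_beta intro!: sum.cong)
      then show "((\<lambda>i. \<Sum>j\<in>{1..N} \<times> UNIV. case_prod w j * x j i) \<longlongrightarrow> \<eta>) sequentially"
        using reach_step.IH by (simp add: tendsto_cong)
    qed
    moreover have "((s0 \<noteq> d) \<noteq> d') = (s0 \<noteq> (d \<noteq> d'))" by auto
    ultimately show ?case by (simp add: x_def)
  qed
  obtain L where L: "\<And>n d. n \<ge> L \<Longrightarrow> reach w n d" using reach_cofinite by blast
  have all: "(\<lambda>i. G (r i - (L + k)) s) \<longlonglongrightarrow> \<eta>" for k s
    using spread[OF L[of "L + k" "s0 \<noteq> s"]] by (cases s; cases s0) auto
  have "(\<lambda>i. \<Sum>k<N. tail k * (G (r i - (L + k)) False + G (r i - (L + k)) True))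
      \<longlonglongrightarrow> (\<Sum>k<N. tail k * (\<eta> + \<eta>))"
    by (intro tendsto_intros all)
  moreover have "\<forall>\<^sub>F i in sequentially.
      (\<Sum>k<N. tail k * (G (r i - (L + k)) False + G (r i - (L + k)) True)) = K"
    using eventually_compose_filterlim[OF eventually_ge_at_top[of N] lim[of L]]
    by eventually_elim (simp add: conserved diff_diff_left[symmetric] del: diff_diff_left diff_diff_eq)
  ultimately have "(\<lambda>i. K) \<longlonglongrightarrow> (\<Sum>k<N. tail k * (\<eta> + \<eta>))"
    by (simp add: tendsto_cong)
  then have "K = (\<Sum>k<N. tail k * (\<eta> + \<eta>))"
    by (simp add: LIMSEQ_const_iff)
  then have "K = 2 * J * \<eta>"
    by (simp add: sum_distrib_right[symmetric] sum_tail)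
  then have "\<eta> = K / (2 * J)" using J_ge_1 by simp
  then show ?thesis using upper[OF \<open>e > 0\<close>] by simp
qed

lemma fundamental_tendsto: "(\<lambda>n. F n s) \<longlonglongrightarrow> 1 / (2 * J)"
proof (rule tendstoI)
  fix e :: real assume "e > 0"
  have "\<forall>\<^sub>F n in sequentially. F n s < 1 / (2 * J) + e"
    using F_bounds \<open>e > 0\<close> 
    by (intro limsup_bound[where B = 1] F_rec_window F_conserved_window) (auto simp: abs_le_iff intro: order.trans[of _ 0])
  moreover have "\<forall>\<^sub>F n in sequentially. - F n s < - 1 / (2 * J) + e"
  proof (rule limsup_bound[where B = 1])
    show "\<bar>- F n s\<bar> \<le> 1" for n s using F_bounds by (auto simp: abs_le_iff intro: order.trans[of _ 0])
    show "- F n s = (\<Sum>(k, d)\<in>{1..N} \<times> UNIV. w k d * - F (n - k) (s \<noteq> d))" if "n \<ge> N" for n s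
      by (subst F_rec_window[OF that]) (simp add: sum_negf[symmetric] case_prod_beta)
    show "(\<Sum>k<N. tail k * (- F (n - k) False + - F (n - k) True)) = - 1" if "n \<ge> N" for n
      using arg_cong[OF F_conserved_window[OF that], of uminus]
      by (simp add: sum_negf[symmetric] algebra_simps)
  qed fact
  ultimately show "\<forall>\<^sub>F n in sequentially. dist (F n s) (1 / (2 * J)) < e"
    by eventually_elim (auto simp: dist_real_def abs_less_iff)
qed

end

section \<open>Solutions as convolutions\<close>

text \<open>The convolution of a sequence with a function that vanishes on the non-positive half-line. For
  such functions the terms with \<open>m \<ge> t\<close> are zero, so the sum may be extended to any upper bound
  \<open>M \<ge> t\<close> (\<open>convolve_eq\<close>).\<close>

definition convolve :: "(nat \<Rightarrow> real) \<Rightarrow> (real \<Rightarrow> real) \<Rightarrow> real \<Rightarrow> real" where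
  "convolve f X t = (\<Sum>m\<le>nat \<lceil>t\<rceil>. f m * X (t - real m))"

lemma convolve_eq:
  assumes X: "\<And>t. t \<le> 0 \<Longrightarrow> X t = 0" and "t \<le> real M"
  shows "convolve f X t = (\<Sum>m\<le>M. f m * X (t - real m))"
proof -
  have "nat \<lceil>t\<rceil> \<le> M" using assms(2) by linarith
  moreover have "X (t - real m) = 0" if "m > nat \<lceil>t\<rceil>" for m
    using that by (intro X) linarith
  ultimately show ?thesis
    unfolding convolve_def by (intro sum.mono_neutral_left) auto
qed

lemma convolve_nonpos:
  assumes X: "\<And>t. t \<le> 0 \<Longrightarrow> X t = 0" and "t \<le> 0"
  shows "convolve f X t = 0"
  using convolve_eq[of X t 0 f] assms by simp

lemma continuous_on_if_continuous_on_intervals: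
  fixes f :: "real \<Rightarrow> real"
  assumes "\<And>M::nat. continuous_on {- real M<..<real M} f"
  shows "continuous_on UNIV f"
proof -
  have "isCont f t" for t
  proof -
    obtain M :: nat where M: "\<bar>t\<bar> < real M" using reals_Archimedean2 by blast
    have "t \<in> {- real M<..<real M}" using M by auto
    then show ?thesis
      using assms[of M] continuous_on_eq_continuous_at[OF open_greaterThanLessThan] by blast
  qed
  then show ?thesis by (simp add: continuous_on_eq_continuous_at)
qed

lemma continuous_on_convolve:
  assumes X: "\<And>t. t \<le> 0 \<Longrightarrow> X t = 0" and cont: "continuous_on UNIV X"
  shows "continuous_on UNIV (convolve f X)"
proof (rule continuous_on_if_continuous_on_intervals)
  fix M :: nat
  have "continuous_on {- real M<..<real M} (\<lambda>t. \<Sum>m\<le>M. f m * X (t - real m))"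
    by (intro continuous_intros continuous_on_compose2[OF cont]) auto
  moreover have eq: "convolve f X t = (\<Sum>m\<le>M. f m * X (t - real m))" if "t \<in> {- real M<..<real M}" for t
    using that by (intro convolve_eq X) auto
  ultimately show "continuous_on {- real M<..<real M} (convolve f X)"
    by (subst continuous_on_cong[OF refl eq])
qed

lemma convolve_shift:
  fixes c :: "nat \<Rightarrow> real"
  assumes X: "\<And>t. t \<le> 0 \<Longrightarrow> X t = 0" and t: "t \<le> real M"
    and c: "\<And>k. k \<notin> {1..N} \<Longrightarrow> c k = 0"
  shows "(\<Sum>n\<le>M. (\<Sum>m<n. c (n - m) * g m) * X (t - real n))
       = (\<Sum>k=1..N. c k * convolve g X (t - real k))"
proof -
  define h where "h m n = c (n - m) * g m * X (t - real n)" for m n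
  have "(\<Sum>n\<le>M. (\<Sum>m<n. c (n - m) * g m) * X (t - real n)) = (\<Sum>n\<le>M. \<Sum>m<n. h m n)"
    by (simp add: h_def sum_distrib_right)
  also have "\<dots> = (\<Sum>n\<le>M. \<Sum>m\<le>M. if m < n then h m n else 0)"
    by (intro sum.cong refl sum.mono_neutral_cong_left) auto
  also have "\<dots> = (\<Sum>m\<le>M. \<Sum>n\<le>M. if m < n then h m n else 0)"
    by (rule sum.swap)
  also have "\<dots> = (\<Sum>m\<le>M. \<Sum>n\<in>{1+m..N+m}. h m n)"
  proof (rule sum.cong[OF refl], rule sum.mono_neutral_cong)
    fix m n
    show "h m n = 0" if "n \<in> {1+m..N+m} - {..M}"
      using that t by (auto simp: h_def intro!: X)
    show "(if m < n then h m n else 0) = 0" if "n \<in> {..M} - {1+m..N+m}"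
      using that by (auto simp: h_def intro!: c)
  qed auto
  also have "\<dots> = (\<Sum>m\<le>M. \<Sum>k=1..N. h m (k + m))"
    by (simp only: sum.shift_bounds_cl_nat_ivl)
  also have "\<dots> = (\<Sum>k=1..N. \<Sum>m\<le>M. h m (k + m))"
    by (rule sum.swap)
  also have "\<dots> = (\<Sum>k=1..N. c k * (\<Sum>m\<le>M. g m * X ((t - real k) - real m)))"
    by (simp add: h_def sum_distrib_left mult.assoc diff_diff_eq)
  also have "\<dots> = (\<Sum>k=1..N. c k * convolve g X (t - real k))"
    using t by (intro sum.cong refl arg_cong2[of _ _ _ _ "(*)"] convolve_eq[OF X, symmetric]) auto
  finally show ?thesis .
qed

lemma continuous_vanishing_nonpos:
  fixes f :: "real \<Rightarrow> real"
  assumes "continuous_on UNIV f" "\<And>t. t < 0 \<Longrightarrow> f t = 0" "t \<le> 0"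
  shows "f t = 0"
proof (rule continuous_constant_on_closure[of "{..<0}" f])
  show "continuous_on (closure {..<0}) f" using assms(1) continuous_on_subset by blast
  show "t \<in> closure {..<0}" using assms(3) by simp
qed (use assms in auto)

context renewal_walk
begin

text \<open>Convolving with an input turns the discrete recursion into the renewal equation; the term at
  \<open>n = 0\<close> supplies the input itself, which is present in component \<open>False\<close> only.\<close>

lemma convolve_F:
  assumes X: "\<And>t. t \<le> 0 \<Longrightarrow> X t = 0"
  shows "convolve (\<lambda>n. F n s) X t = F 0 s * X t +
    (\<Sum>k=1..N. w k False * convolve (\<lambda>n. F n s) X (t - real k) +
              w k True * convolve (\<lambda>n. F n (\<not> s)) X (t - real k))"
proof -
  obtain M where M: "t \<le> real M" using real_arch_simple by blast
  define R where "R n = (\<Sum>m<n. w (n - m) False * F m s) + (\<Sum>m<n. w (n - m) True * F m (\<not> s))" for n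
  have F_R: "F n s = (if n = 0 then F 0 s else 0) + R n" for n
    by (cases n) (simp_all add: R_def sum.distrib lessThan_Suc_atMost)
  have "convolve (\<lambda>n. F n s) X t = (\<Sum>n\<le>M. ((if n = 0 then F 0 s else 0) + R n) * X (t - real n))"
    by (subst convolve_eq[OF X M]) (simp_all only: F_R[symmetric])
  also have "\<dots> = (\<Sum>n\<le>M. if n = 0 then F 0 s * X t else 0) + (\<Sum>n\<le>M. R n * X (t - real n))"
    unfolding sum.distrib[symmetric] by (intro sum.cong refl) (simp add: distrib_right)
  also have "(\<Sum>n\<le>M. if n = 0 then F 0 s * X t else 0) = F 0 s * X t"
    by simp
  also have "(\<Sum>n\<le>M. R n * X (t - real n)) =
      (\<Sum>k=1..N. w k False * convolve (\<lambda>n. F n s) X (t - real k)) +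
      (\<Sum>k=1..N. w k True * convolve (\<lambda>n. F n (\<not> s)) X (t - real k))"
    using convolve_shift[where X = X and N = N and c = "\<lambda>k. w k False" and g = "\<lambda>m. F m s", OF X M]
      convolve_shift[where X = X and N = N and c = "\<lambda>k. w k True" and g = "\<lambda>m. F m (\<not> s)", OF X M] w_support
    by (simp add: R_def distrib_right sum.distrib)
  finally show ?thesis by (simp add: sum.distrib)
qed

abbreviation u where "u k \<equiv> w k False"
abbreviation v where "v k \<equiv> w k True"

lemma renewal_solution_convolve:
  assumes X1: "\<And>t. t \<le> 0 \<Longrightarrow> X1 t = 0" and X2: "\<And>t. t \<le> 0 \<Longrightarrow> X2 t = 0"
    and cont: "continuous_on UNIV X1" "continuous_on UNIV X2"
  shows "renewal_solution N u v X1 X2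
    (\<lambda>t. convolve (\<lambda>n. F n False) X1 t + convolve (\<lambda>n. F n True) X2 t)
    (\<lambda>t. convolve (\<lambda>n. F n True) X1 t + convolve (\<lambda>n. F n False) X2 t)"
  unfolding renewal_solution_def renewal_equation_def
proof (intro conjI allI impI continuous_intros continuous_on_convolve X1 X2 cont)
  fix t :: real
  show "convolve (\<lambda>n. F n False) X1 t + convolve (\<lambda>n. F n True) X2 t = X1 t +
      (\<Sum>k=1..N. u k * (convolve (\<lambda>n. F n False) X1 (t - real k) + convolve (\<lambda>n. F n True) X2 (t - real k)) +
         v k * (convolve (\<lambda>n. F n True) X1 (t - real k) + convolve (\<lambda>n. F n False) X2 (t - real k)))"
    using convolve_F[where X = X1 and s = False and t = t, OF X1] convolve_F[where X = X2 and s = True and t = t, OF X2]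
    by (simp add: sum.distrib algebra_simps)
  show "convolve (\<lambda>n. F n True) X1 t + convolve (\<lambda>n. F n False) X2 t = X2 t +
      (\<Sum>k=1..N. u k * (convolve (\<lambda>n. F n True) X1 (t - real k) + convolve (\<lambda>n. F n False) X2 (t - real k)) +
         v k * (convolve (\<lambda>n. F n False) X1 (t - real k) + convolve (\<lambda>n. F n True) X2 (t - real k)))"
    using convolve_F[where X = X1 and s = True and t = t, OF X1] convolve_F[where X = X2 and s = False and t = t, OF X2]
    by (simp add: sum.distrib algebra_simps)
qed (use convolve_nonpos X1 X2 in auto)

end

text \<open>The equation determines the values on \<open>{n<..n + 1}\<close> from those on \<open>{..n}\<close>, because all delays
  are at least \<open>1\<close>; the value at \<open>0\<close>, which the equation does not cover, is fixed by continuity.\<close>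

lemma renewal_solution_unique:
  assumes Z: "renewal_solution N u v X1 X2 Z1 Z2" and Z': "renewal_solution N u v X1 X2 Z1' Z2'"
  shows "Z1 = Z1' \<and> Z2 = Z2'"
proof -
  have nonpos: "Z1 t = 0 \<and> Z2 t = 0" if "renewal_solution N u v X1 X2 Z1 Z2" "t \<le> 0" for Z1 Z2 t
    using that unfolding renewal_solution_def by (auto intro: continuous_vanishing_nonpos)
  have agree: "Z1 t = Z1' t \<and> Z2 t = Z2' t" if "t \<le> real n" for n t
    using that
  proof (induction n arbitrary: t)
    case 0
    then show ?case using nonpos[OF Z, of t] nonpos[OF Z', of t] by simp
  next
    case (Suc n)
    show ?case
    proof (cases "t > 0")
      case True
      have "Z1 (t - real k) = Z1' (t - real k) \<and> Z2 (t - real k) = Z2' (t - real k)"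
        if "k \<in> {1..N}" for k
        using Suc.prems that by (intro Suc.IH) auto
      then show ?thesis
        using Z Z' True unfolding renewal_solution_def renewal_equation_def by simp
    next
      case False
      then show ?thesis using nonpos[OF Z, of t] nonpos[OF Z', of t] by simp
    qed
  qed
  show ?thesis using agree real_arch_simple by (metis ext)
qed

section \<open>Periodization\<close>

context
  fixes \<tau> P :: real and X :: "real \<Rightarrow> real"
  assumes \<tau>: "\<tau> > 0" and X_zero: "\<And>t. t \<le> 0 \<Longrightarrow> X t = 0"
    and X_bound: "\<And>t. \<bar>X t\<bar> \<le> P * exp (- \<tau> * t)"
begin

lemma bound_geometric: "\<bar>X (t + real m)\<bar> \<le> P * exp (- \<tau> * t) * exp (- \<tau>) ^ m"
proof -
  have "exp (- \<tau> * (t + real m)) = exp (- \<tau> * t) * exp (- \<tau>) ^ m"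
    by (simp add: exp_of_nat_mult[symmetric] exp_add[symmetric] algebra_simps)
  then show ?thesis using X_bound[of "t + real m"] by (simp add: mult.assoc)
qed

lemma summable_geometric_bound: "summable (\<lambda>m. K * exp (- \<tau>) ^ m)"
  using \<tau> by (intro summable_mult summable_geometric) auto

lemma summable_abs_translates: "summable (\<lambda>m. \<bar>X (t + real m)\<bar>)"
  by (rule summable_comparison_test_ev[OF always_eventually summable_geometric_bound[of "P * exp (- \<tau> * t)"]])
    (use bound_geometric[of t] in simp)

text \<open>For \<open>t \<le> B\<close> the terms with \<open>k > B\<close> vanish, so the two-sided series is the ordinary series
  obtained from the substitution \<open>k = B - m\<close>.\<close>

lemma periodization_has_sum:
  fixes B :: int
  assumes "t \<le> of_int B"
  shows "((\<lambda>k::int. X (t - of_int k)) has_sum (\<Sum>m. X (t - of_int B + real m))) UNIV"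
proof -
  have "summable (\<lambda>m. norm (X (t - of_int B + real m)))"
    using summable_abs_translates[of "t - of_int B"] by simp
  then have "((\<lambda>m. X (t - of_int B + real m)) has_sum (\<Sum>m. X (t - of_int B + real m))) (UNIV :: nat set)"
    by (intro norm_summable_imp_has_sum summable_sums) (auto intro: summable_norm_cancel)
  also have "?this \<longleftrightarrow> ((\<lambda>k::int. X (t - of_int k)) has_sum (\<Sum>m. X (t - of_int B + real m))) {..B}"
    by (rule has_sum_reindex_bij_witness[of _ "\<lambda>k. nat (B - k)" "\<lambda>m. B - int m"])
      (auto simp: algebra_simps)
  also have "\<dots> \<longleftrightarrow> ((\<lambda>k::int. X (t - of_int k)) has_sum (\<Sum>m. X (t - of_int B + real m))) UNIV"
    using assms by (intro has_sum_cong_neutral) (auto intro!: X_zero)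
  finally show ?thesis .
qed

lemma periodization_eq:
  fixes B :: int
  assumes "t \<le> of_int B"
  shows "(\<Sum>\<^sub>\<infinity>k::int. X (t - of_int k)) = (\<Sum>m. X (t - of_int B + real m))"
  using periodization_has_sum[OF assms] by (rule infsumI)

lemma periodization_periodic:
  "(\<Sum>\<^sub>\<infinity>k::int. X (t + 1 - of_int k)) = (\<Sum>\<^sub>\<infinity>k::int. X (t - of_int k))"
  using periodization_eq[of t "\<lceil>t\<rceil>"] periodization_eq[of "t + 1" "\<lceil>t\<rceil> + 1"] by simp

lemma continuous_on_periodization:
  assumes cont: "continuous_on UNIV X"
  shows "continuous_on UNIV (\<lambda>t. \<Sum>\<^sub>\<infinity>k::int. X (t - of_int k))"
proof (rule continuous_on_if_continuous_on_intervals)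
  fix M :: nat
  let ?I = "{- real M<..<real M}"
  have "uniform_limit ?I (\<lambda>n t. \<Sum>m<n. X (t - real M + real m))
      (\<lambda>t. \<Sum>m. X (t - real M + real m)) sequentially"
  proof (rule Weierstrass_m_test[OF _ summable_geometric_bound])
    fix m t assume t: "t \<in> ?I"
    have "P \<ge> 0" using X_bound[of 0] by simp
    have "norm (X (t - real M + real m)) \<le> P * exp (- \<tau> * (t - real M)) * exp (- \<tau>) ^ m"
      using bound_geometric[of "t - real M" m] by simp
    also have "\<dots> \<le> P * exp (\<tau> * (2 * real M)) * exp (- \<tau>) ^ m"
    proof -
      have "\<tau> * (real M - t) \<le> \<tau> * (2 * real M)"
        using t \<tau> by (intro mult_left_mono) auto
      then show ?thesis
        using \<open>P \<ge> 0\<close> by (intro mult_right_mono mult_left_mono) (auto simp: algebra_simps)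
    qed
    finally show "norm (X (t - real M + real m)) \<le> P * exp (\<tau> * (2 * real M)) * exp (- \<tau>) ^ m" .
  qed
  then have "continuous_on ?I (\<lambda>t. \<Sum>m. X (t - real M + real m))"
    by (rule uniform_limit_theorem[rotated])
      (auto intro!: always_eventually continuous_intros continuous_on_compose2[OF cont])
  moreover have eq: "(\<Sum>\<^sub>\<infinity>k::int. X (t - of_int k)) = (\<Sum>m. X (t - real M + real m))" if "t \<in> ?I" for t
    using periodization_eq[of t "int M"] that by simp
  ultimately show "continuous_on ?I (\<lambda>t. \<Sum>\<^sub>\<infinity>k::int. X (t - of_int k))"
    by (subst continuous_on_cong[OF refl eq])
qed

lemma periodization_truncation_error:
  assumes "t \<le> real M"
  shows "\<bar>(\<Sum>\<^sub>\<infinity>k::int. X (t - of_int k)) - (\<Sum>m\<le>M. X (t - real m))\<bar>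
      \<le> P * exp (- \<tau> * t) / (1 - exp (- \<tau>))"
proof -
  define y where "y m = X (t - real M + real m)" for m
  have y: "summable (\<lambda>m. \<bar>y m\<bar>)" unfolding y_def by (rule summable_abs_translates)
  then have "summable y" by (rule summable_rabs_cancel)
  have y_shift: "y (m + Suc M) = X (t + real (Suc m))" for m
    by (simp add: y_def algebra_simps)
  have "(\<Sum>m\<le>M. X (t - real m)) = (\<Sum>m<Suc M. y m)"
    unfolding lessThan_Suc_atMost y_def
    by (rule sum.reindex_bij_witness[of _ "\<lambda>k. M - k" "\<lambda>m. M - m"]) (auto simp: of_nat_diff)
  moreover have "(\<Sum>\<^sub>\<infinity>k::int. X (t - of_int k)) = (\<Sum>m. y m)"
    using periodization_eq[of t "int M"] assms by (simp add: y_def)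
  ultimately have "(\<Sum>\<^sub>\<infinity>k::int. X (t - of_int k)) - (\<Sum>m\<le>M. X (t - real m)) = (\<Sum>m. y (m + Suc M))"
    using suminf_split_initial_segment[OF \<open>summable y\<close>, of "Suc M"] by simp
  also have "\<bar>\<dots>\<bar> \<le> (\<Sum>m. \<bar>y (m + Suc M)\<bar>)"
    by (intro summable_rabs summable_ignore_initial_segment[OF y])
  also have "\<dots> \<le> (\<Sum>m. P * exp (- \<tau> * t) * exp (- \<tau>) ^ m)"
  proof (rule suminf_le[OF _ _ summable_geometric_bound])
    show "\<bar>y (m + Suc M)\<bar> \<le> P * exp (- \<tau> * t) * exp (- \<tau>) ^ m" for m
    proof -
      have "P \<ge> 0" using X_bound[of 0] by simp
      then have "P * exp (- \<tau> * t) * exp (- \<tau>) ^ Suc m \<le> P * exp (- \<tau> * t) * exp (- \<tau>) ^ m"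
        using \<tau> by (intro mult_left_mono power_decreasing) auto
      then show ?thesis
        using bound_geometric[of t "Suc m"] unfolding y_shift by linarith
    qed
    show "summable (\<lambda>m. \<bar>y (m + Suc M)\<bar>)"
      by (rule summable_ignore_initial_segment[OF y])
  qed
  also have "\<dots> = P * exp (- \<tau> * t) * (\<Sum>m. exp (- \<tau>) ^ m)"
    using \<tau> by (intro suminf_mult summable_geometric) auto
  also have "(\<Sum>m. exp (- \<tau>) ^ m) = 1 / (1 - exp (- \<tau>))"
    using \<tau> by (intro suminf_geometric) auto
  finally show ?thesis by simp
qed

end

section \<open>Convergence to the periodic limit\<close>

context renewal_walk
begin

text \<open>The distance of the fundamental solution from its limit, summed over both components.\<close>

definition deviation :: "nat \<Rightarrow> real" where
  "deviation m = \<bar>F m False - 1 / (2 * J)\<bar> + \<bar>F m True - 1 / (2 * J)\<bar>"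

text \<open>The common rate of convergence. The first summand bounds the effect of the deviations; its
  factor \<open>exp \<tau>\<close> compensates for replacing \<open>t\<close> by \<open>\<lceil>t\<rceil>\<close> in the exponential decay of the
  inputs. The second summand bounds the part of the periodic limit that evaluates the inputs at
  times after \<open>t\<close>.\<close>

definition rate :: "real \<Rightarrow> real \<Rightarrow> real" where
  "rate \<tau> t = exp \<tau> * (\<Sum>m\<le>nat \<lceil>t\<rceil>. deviation m * exp (- \<tau>) ^ (nat \<lceil>t\<rceil> - m)) +
     1 / (2 * J) * (exp (- \<tau> * t) / (1 - exp (- \<tau>)))"

lemma deviation_bound: "\<bar>F m s - 1 / (2 * J)\<bar> \<le> deviation m"
  by (cases s) (auto simp: deviation_def)

lemma rate_tendsto_0:
  assumes "\<tau> > 0"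
  shows "(rate \<tau> \<longlongrightarrow> 0) at_top"
proof -
  have "deviation \<longlonglongrightarrow> \<bar>1 / (2 * J) - 1 / (2 * J)\<bar> + \<bar>1 / (2 * J) - 1 / (2 * J)\<bar>"
    unfolding deviation_def by (intro tendsto_intros fundamental_tendsto)
  then have "deviation \<longlonglongrightarrow> 0" by simp
  then have "(\<lambda>M. \<Sum>m\<le>M. deviation m * exp (- \<tau>) ^ (M - m)) \<longlonglongrightarrow> 0"
  proof (rule geometric_convolution_tendsto_zero)
    show "deviation n \<ge> 0" for n by (simp add: deviation_def)
  qed (use assms in auto)
  moreover have "filterlim (\<lambda>t::real. nat \<lceil>t\<rceil>) sequentially at_top"
    unfolding filterlim_at_top
  proof
    fix M :: nat
    show "\<forall>\<^sub>F t::real in at_top. M \<le> nat \<lceil>t\<rceil>"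
      using eventually_ge_at_top[of "real M"] by eventually_elim linarith
  qed
  ultimately have "((\<lambda>t::real. \<Sum>m\<le>nat \<lceil>t\<rceil>. deviation m * exp (- \<tau>) ^ (nat \<lceil>t\<rceil> - m)) \<longlongrightarrow> 0) at_top"
    by (rule filterlim_compose[where g = "\<lambda>M. \<Sum>m\<le>M. deviation m * exp (- \<tau>) ^ (M - m)"])
  moreover have "((\<lambda>t. exp (- \<tau> * t)) \<longlongrightarrow> 0) at_top"
    using assms by real_asymp
  ultimately have "(rate \<tau> \<longlongrightarrow> exp \<tau> * 0 + 1 / (2 * J) * (0 / (1 - exp (- \<tau>)))) at_top"
    unfolding rate_def using assms by (intro tendsto_intros) auto
  then show ?thesis by simp
qed

lemma convolve_near_periodization:
  assumes \<tau>: "\<tau> > 0" and t: "t > 0"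
    and X_zero: "\<And>t. t \<le> 0 \<Longrightarrow> X t = 0" and X_bound: "\<And>t. \<bar>X t\<bar> \<le> P * exp (- \<tau> * t)"
    and Y_zero: "\<And>t. t \<le> 0 \<Longrightarrow> Y t = 0" and Y_bound: "\<And>t. \<bar>Y t\<bar> \<le> Q * exp (- \<tau> * t)"
  shows "\<bar>convolve (\<lambda>n. F n s) X t + convolve (\<lambda>n. F n (\<not> s)) Y t
      - 1 / (2 * J) * (\<Sum>\<^sub>\<infinity>k::int. X (t - of_int k) + Y (t - of_int k))\<bar> \<le> (P + Q) * rate \<tau> t"
proof -
  define M where "M = nat \<lceil>t\<rceil>"
  define c where "c = 1 / (2 * J)"
  define S where "S = (\<Sum>\<^sub>\<infinity>k::int. X (t - of_int k) + Y (t - of_int k))"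
  have c: "c \<ge> 0" using J_ge_1 by (simp add: c_def)
  have M: "t \<le> real M" "real M \<le> t + 1" using t unfolding M_def by linarith+
  have PQ: "P \<ge> 0" "Q \<ge> 0" using X_bound[of 0] Y_bound[of 0] by simp_all
  have exp_bound: "exp (- \<tau> * (t - real m)) \<le> exp \<tau> * exp (- \<tau>) ^ (M - m)" if "m \<le> M" for m
  proof -
    have "- \<tau> * (t - real m) \<le> - \<tau> * (real M - 1 - real m)"
      using M \<tau> by (intro mult_left_mono_neg) auto
    also have "\<dots> = \<tau> + real (M - m) * (- \<tau>)"
      using that by (simp add: of_nat_diff algebra_simps)
    finally have "exp (- \<tau> * (t - real m)) \<le> exp (\<tau> + real (M - m) * (- \<tau>))" by simp
    also have "\<dots> = exp \<tau> * exp (- \<tau>) ^ (M - m)" by (simp only: exp_add exp_of_nat_mult)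
    finally show ?thesis .
  qed
  have term_bound: "\<bar>(F m s' - c) * f (t - real m)\<bar> \<le> deviation m * (K * (exp \<tau> * exp (- \<tau>) ^ (M - m)))"
    if "m \<le> M" and f: "\<And>t. \<bar>f t\<bar> \<le> K * exp (- \<tau> * t)" and K: "K \<ge> 0" for m s' f K
  proof -
    have "\<bar>f (t - real m)\<bar> \<le> K * (exp \<tau> * exp (- \<tau>) ^ (M - m))"
      using f[of "t - real m"] mult_left_mono[OF exp_bound[OF \<open>m \<le> M\<close>] K] by linarith
    then show ?thesis
      unfolding abs_mult using deviation_bound[of m s']
      by (intro mult_mono) (auto simp: c_def)
  qed
  have sum_bound: "\<bar>\<Sum>m\<le>M. (F m s - c) * X (t - real m) + (F m (\<not> s) - c) * Y (t - real m)\<bar>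
      \<le> (\<Sum>m\<le>M. (P + Q) * (exp \<tau> * (deviation m * exp (- \<tau>) ^ (M - m))))"
  proof (rule order.trans[OF sum_abs], rule sum_mono)
    fix m assume "m \<in> {..M}"
    then have "m \<le> M" by simp
    have "\<bar>(F m s - c) * X (t - real m) + (F m (\<not> s) - c) * Y (t - real m)\<bar>
        \<le> \<bar>(F m s - c) * X (t - real m)\<bar> + \<bar>(F m (\<not> s) - c) * Y (t - real m)\<bar>"
      by (rule abs_triangle_ineq)
    also have "\<dots> \<le> deviation m * (P * (exp \<tau> * exp (- \<tau>) ^ (M - m)))
        + deviation m * (Q * (exp \<tau> * exp (- \<tau>) ^ (M - m)))"
      using \<open>m \<le> M\<close> X_bound Y_bound PQ by (intro add_mono term_bound)
    also have "\<dots> = (P + Q) * (exp \<tau> * (deviation m * exp (- \<tau>) ^ (M - m)))"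
      by (simp add: algebra_simps)
    finally show "\<bar>(F m s - c) * X (t - real m) + (F m (\<not> s) - c) * Y (t - real m)\<bar>
        \<le> (P + Q) * (exp \<tau> * (deviation m * exp (- \<tau>) ^ (M - m)))" .
  qed
  have tail_bound: "\<bar>S - (\<Sum>m\<le>M. X (t - real m) + Y (t - real m))\<bar>
      \<le> (P + Q) * exp (- \<tau> * t) / (1 - exp (- \<tau>))"
    unfolding S_def
  proof (rule periodization_truncation_error[where X = "\<lambda>t. X t + Y t", OF \<tau> _ _ M(1)])
    show "\<bar>X t + Y t\<bar> \<le> (P + Q) * exp (- \<tau> * t)" for t
      using X_bound[of t] Y_bound[of t] by (simp add: distrib_right)
  qed (simp add: X_zero Y_zero)
  have split: "convolve (\<lambda>n. F n s) X t + convolve (\<lambda>n. F n (\<not> s)) Y t - c * S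
      = (\<Sum>m\<le>M. (F m s - c) * X (t - real m) + (F m (\<not> s) - c) * Y (t - real m))
        - c * (S - (\<Sum>m\<le>M. X (t - real m) + Y (t - real m)))"
    by (simp add: convolve_eq[where X = X, OF X_zero M(1)] convolve_eq[where X = Y, OF Y_zero M(1)]
        left_diff_distrib right_diff_distrib distrib_left sum.distrib sum_subtractf sum_distrib_left)
  have "\<bar>convolve (\<lambda>n. F n s) X t + convolve (\<lambda>n. F n (\<not> s)) Y t - c * S\<bar>
      \<le> \<bar>\<Sum>m\<le>M. (F m s - c) * X (t - real m) + (F m (\<not> s) - c) * Y (t - real m)\<bar>
        + c * \<bar>S - (\<Sum>m\<le>M. X (t - real m) + Y (t - real m))\<bar>"
    unfolding split by (rule order.trans[OF abs_triangle_ineq4]) (use c in \<open>simp add: abs_mult\<close>)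
  also have "\<dots> \<le> (\<Sum>m\<le>M. (P + Q) * (exp \<tau> * (deviation m * exp (- \<tau>) ^ (M - m))))
      + c * ((P + Q) * exp (- \<tau> * t) / (1 - exp (- \<tau>)))"
    by (rule add_mono[OF sum_bound mult_left_mono[OF tail_bound c]])
  also have "\<dots> = (P + Q) * rate \<tau> t"
    unfolding rate_def M_def[symmetric] c_def[symmetric] sum_distrib_left[symmetric]
    by (simp only: distrib_left mult.left_commute[of c] times_divide_eq_right)
  finally show ?thesis by (simp only: S_def c_def)
qed

end

lemma renewal_solution_cong:
  assumes "\<And>k. k \<in> {1..N} \<Longrightarrow> u k = u' k" "\<And>k. k \<in> {1..N} \<Longrightarrow> v k = v' k"
  shows "renewal_solution N u v X1 X2 Z1 Z2 \<longleftrightarrow> renewal_solution N u' v' X1 X2 Z1 Z2"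
proof -
  have "renewal_equation N u v X Z W \<longleftrightarrow> renewal_equation N u' v' X Z W" for X Z W
    unfolding renewal_equation_def using assms by simp
  then show ?thesis by (simp add: renewal_solution_def)
qed

lemma admissible_input_nonpos:
  assumes "admissible_input \<tau> P X" "t \<le> 0"
  shows "X t = 0"
  using assms continuous_vanishing_nonpos unfolding admissible_input_def by blast

lemma admissible_input_bound:
  assumes "admissible_input \<tau> P X" "P > 0"
  shows "\<bar>X t\<bar> \<le> P * exp (- \<tau> * t)"
proof (cases "t > 0")
  case False
  then show ?thesis using admissible_input_nonpos[OF assms(1), of t] assms(2) by simp
qed (use assms in \<open>simp add: admissible_input_def\<close>)

theorem mainTheorem4:
  fixes \<tau> :: real and N :: nat and u v :: "nat \<Rightarrow> real"
  assumes "\<tau> > 0"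
    and "\<And>k. k \<in> {1..N} \<Longrightarrow> u k \<ge> 0"
    and "\<And>k. k \<in> {1..N} \<Longrightarrow> v k \<ge> 0"
    and "(\<Sum>k=1..N. u k + v k) = 1"
    and "(\<Sum>k=1..N. v k) > 0"
    and "Gcd {k \<in> {1..N}. u k + v k > 0} = 1"
    and "(\<exists>k\<in>{1..N}. odd k \<and> u k > 0) \<or> (\<exists>k\<in>{1..N}. even k \<and> v k > 0)"
  shows "\<exists>C :: real \<Rightarrow> real. (C \<longlongrightarrow> 0) at_top \<and>
    (\<forall>P1 P2 X1 X2. P1 > 0 \<longrightarrow> P2 > 0 \<longrightarrow>
        admissible_input \<tau> P1 X1 \<longrightarrow> admissible_input \<tau> P2 X2 \<longrightarrow>
      (\<exists>!(Z1, Z2). renewal_solution N u v X1 X2 Z1 Z2) \<and>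
      (\<forall>t. (\<lambda>k::int. X1 (t - real_of_int k) + X2 (t - real_of_int k)) summable_on UNIV) \<and>
      continuous_on UNIV (periodic_limit N u v X1 X2) \<and>
      (\<forall>t. periodic_limit N u v X1 X2 (t + 1) = periodic_limit N u v X1 X2 t) \<and>
      (\<forall>Z1 Z2. renewal_solution N u v X1 X2 Z1 Z2 \<longrightarrow>
        (\<forall>t>0. \<bar>Z1 t - periodic_limit N u v X1 X2 t\<bar> \<le> (P1 + P2) * C t \<and>
               \<bar>Z2 t - periodic_limit N u v X1 X2 t\<bar> \<le> (P1 + P2) * C t)))"
proof -
  \<comment> \<open>Nothing is known about \<open>u\<close> and \<open>v\<close> outside \<open>{1..N}\<close>, so they are cut off there.\<close>
  define w :: "nat \<Rightarrow> bool \<Rightarrow> real"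
    where "w k d = (if k \<in> {1..N} then if d then v k else u k else 0)" for k d
  have w_pos: "{k. \<exists>d. w k d > 0} = {k \<in> {1..N}. u k + v k > 0}"
  proof -
    have "(\<exists>d. w k d > 0) \<longleftrightarrow> u k + v k > 0" if "k \<in> {1..N}" for k
      using that assms(2)[of k] assms(3)[of k] by (auto simp: w_def ex_bool_eq)
    moreover have "\<not> (\<exists>d. w k d > 0)" if "k \<notin> {1..N}" for k
      using that by (auto simp: w_def)
    ultimately show ?thesis by blast
  qed
  interpret renewal_walk N w
  proof
    show "w k d \<ge> 0" for k d using assms(2,3) by (simp add: w_def)
    show "w k d = 0" if "k \<notin> {1..N}" for k d using that by (auto simp: w_def)
    show "(\<Sum>k=1..N. w k False + w k True) = 1"
      using assms(4) by (simp add: w_def)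
    obtain k0 where "k0 \<in> {1..N}" "v k0 > 0"
      using assms(5) sum_nonpos[of "{1..N}" v] by (meson not_less)
    then have "w k0 True > 0" by (simp add: w_def)
    moreover have "\<exists>k1. odd k1 \<and> w k1 False > 0 \<or> even k1 \<and> w k1 True > 0"
      using assms(7)
    proof (elim disjE bexE conjE)
      fix k assume "k \<in> {1..N}" "odd k" "u k > 0"
      then show ?thesis by (intro exI[of _ k]) (simp add: w_def)
    next
      fix k assume "k \<in> {1..N}" "even k" "v k > 0"
      then show ?thesis by (intro exI[of _ k]) (simp add: w_def)
    qed
    then obtain k1 where "odd k1 \<and> w k1 False > 0 \<or> even k1 \<and> w k1 True > 0" ..
    ultimately show "\<exists>L. \<forall>n\<ge>L. \<forall>d. reach w n d"
      using assms(6) reach_cofinite_if_aperiodic unfolding w_pos[symmetric] by blast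
  qed
  have J: "mean_step N u v = J"
    by (simp add: mean_step_def J_def w_def)
  have solution_iff: "renewal_solution N u v X1 X2 Z1 Z2 \<longleftrightarrow>
      renewal_solution N (\<lambda>k. w k False) (\<lambda>k. w k True) X1 X2 Z1 Z2" for X1 X2 Z1 Z2
    by (rule renewal_solution_cong) (simp_all add: w_def)
  show ?thesis
  proof (intro exI[of _ "rate \<tau>"] conjI allI impI rate_tendsto_0 assms(1))
    fix P1 P2 X1 X2
    assume P: "P1 > 0" "P2 > 0" and X: "admissible_input \<tau> P1 X1" "admissible_input \<tau> P2 X2"
    note zero = admissible_input_nonpos[OF X(1)] admissible_input_nonpos[OF X(2)]
    note bound = admissible_input_bound[OF X(1) P(1)] admissible_input_bound[OF X(2) P(2)]
    have cont: "continuous_on UNIV X1" "continuous_on UNIV X2"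
      using X by (auto simp: admissible_input_def)
    have sum_zero: "X1 t + X2 t = 0" if "t \<le> 0" for t using zero that by simp
    have sum_bound: "\<bar>X1 t + X2 t\<bar> \<le> (P1 + P2) * exp (- \<tau> * t)" for t
      using bound(1)[of t] bound(2)[of t] by (simp add: distrib_right)
    note periodization = assms(1) sum_zero sum_bound
    define Z1 Z2 where "Z1 t = convolve (\<lambda>n. F n False) X1 t + convolve (\<lambda>n. F n True) X2 t"
      and "Z2 t = convolve (\<lambda>n. F n True) X1 t + convolve (\<lambda>n. F n False) X2 t" for t
    have Z: "renewal_solution N u v X1 X2 Z1 Z2"
      unfolding solution_iff Z1_def Z2_def by (rule renewal_solution_convolve[OF zero cont])
    note unique = renewal_solution_unique[OF _ Z]
    show "\<exists>!(Z1, Z2). renewal_solution N u v X1 X2 Z1 Z2"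
    proof (rule ex1I[of _ "(Z1, Z2)"])
      show "case (Z1, Z2) of (Z1, Z2) \<Rightarrow> renewal_solution N u v X1 X2 Z1 Z2"
        using Z by simp
      show "p = (Z1, Z2)" if "case p of (Z1, Z2) \<Rightarrow> renewal_solution N u v X1 X2 Z1 Z2" for p
        using that unique[of "fst p" "snd p"] by (cases p) simp
    qed
    show "(\<lambda>k::int. X1 (t - real_of_int k) + X2 (t - real_of_int k)) summable_on UNIV" for t
      using periodization_has_sum[OF periodization, of t "\<lceil>t\<rceil>"]
      by (auto simp: summable_on_def)
    show "continuous_on UNIV (periodic_limit N u v X1 X2)"
      unfolding periodic_limit_def[abs_def]
      by (intro continuous_on_mult continuous_on_const continuous_on_periodization[OF periodization]
          continuous_on_add cont)
    show "periodic_limit N u v X1 X2 (t + 1) = periodic_limit N u v X1 X2 t" for t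
      using periodization_periodic[OF periodization, of t] by (simp add: periodic_limit_def)
    fix Y1 Y2 and t :: real
    assume sol: "renewal_solution N u v X1 X2 Y1 Y2" and t: "t > 0"
    have Y: "Y1 = Z1" "Y2 = Z2" using unique[OF sol] by simp_all
    show "\<bar>Y1 t - periodic_limit N u v X1 X2 t\<bar> \<le> (P1 + P2) * rate \<tau> t"
      using convolve_near_periodization[where s = False, OF assms(1) t zero(1) bound(1) zero(2) bound(2)]
      by (simp add: Y Z1_def periodic_limit_def J)
    show "\<bar>Y2 t - periodic_limit N u v X1 X2 t\<bar> \<le> (P1 + P2) * rate \<tau> t"
      using convolve_near_periodization[where s = True, OF assms(1) t zero(1) bound(1) zero(2) bound(2)]
      by (simp add: Y Z2_def periodic_limit_def J)
  qed
qed

end
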